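(* Let $n\ge2$, let $\Sigma\subset\mathbb R^n$ be an embedded $C^2$ hypersurface with regular defining function $F:U\to\mathbb R$, let $g_1,\ldots,g_n>0$, and for $t>0$ let $D_t=\operatorname{diag}(t^{g_1},\ldots,t^{g_n})$ and $F_t:D_tU\to\mathbb R$, $F_t(y)=F(D_t^{-1}y)$. Then for every $t>0$ and every $x\in\Sigma\cap U$, $$\mathcal M[F_t](D_tx)=\sum_{1\le i<j\le n}t^{-2(g_i+g_j)}\,C_{ij}[F](x).$$
   Context: A regular defining function of $\Sigma$ near a point of $\Sigma$ is a $C^2$ function $F$ on an open neighborhood $U\subset\mathbb R^n$ of that point with $\Sigma\cap U=\{x\in U:F(x)=0\}$ and $\nabla F\ne0$ on $\Sigma\cap U$. For a $C^2$ function $G$ on an open subset of $\mathbb R^n$, $$\mathcal M[G]=|\nabla G|^2\Delta G-\operatorname{Hess}G(\nabla G,\nabla G).$$ With subscripts on $F$ denoting partial derivatives, for $i<j$, $$C_{ij}[F]=F_j^2F_{ii}+F_i^2F_{jj}-2F_iF_jF_{ij}.$$ *)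

theory Defs
  imports "HOL-Analysis.Analysis"
begin

text \<open>
  Points of \<open>\<real>\<^sup>n\<close> are vectors of type \<open>real^'n\<close>. The index type \<open>'n\<close> is a finite
  linear order where the summation range \<open>i < j\<close> matters. Functions that are only
  given on an open set are total in HOL; their values off that open set play no role,
  since every derivative below is taken at an interior point.
\<close>

definition partial_deriv :: "'n::finite \<Rightarrow> (real^'n \<Rightarrow> real) \<Rightarrow> real^'n \<Rightarrow> real" where
  "partial_deriv i F x = frechet_derivative F (at x) (axis i 1)"

definition gradient :: "(real^'n::finite \<Rightarrow> real) \<Rightarrow> real^'n \<Rightarrow> real^'n" where
  "gradient F x = (\<chi> i. partial_deriv i F x)"

lemma GDERIV_gradient:
  fixes F :: "real^'n::finite \<Rightarrow> real"
  assumes "F differentiable (at x)"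
  shows "GDERIV F x :> gradient F x"
proof -
  have D: "(F has_derivative frechet_derivative F (at x)) (at x)"
    using assms frechet_derivative_works by blast
  then have L: "linear (frechet_derivative F (at x))"
    by (rule has_derivative_linear)
  have "frechet_derivative F (at x) h = h \<bullet> gradient F x" for h
  proof -
    have "frechet_derivative F (at x) h
        = frechet_derivative F (at x) (\<Sum>i\<in>UNIV. h $ i *\<^sub>R axis i 1)"
      by (simp add: basis_expansion flip: scalar_mult_eq_scaleR)
    also have "\<dots> = h \<bullet> gradient F x"
      by (simp add: linear_sum[OF L] linear_scale[OF L] inner_vec_def gradient_def
          partial_deriv_def)
    finally show ?thesis .
  qed
  then have "frechet_derivative F (at x) = (\<lambda>h. h \<bullet> gradient F x)"
    by blast
  with D show ?thesis
    unfolding gderiv_def by simp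
qed

definition hess :: "(real^'n::finite \<Rightarrow> real) \<Rightarrow> real^'n \<Rightarrow> real^'n \<Rightarrow> real^'n \<Rightarrow> real" where
  "hess F x v w = (\<Sum>i\<in>UNIV. \<Sum>j\<in>UNIV. partial_deriv j (partial_deriv i F) x * v $ i * w $ j)"

definition laplacian :: "(real^'n::finite \<Rightarrow> real) \<Rightarrow> real^'n \<Rightarrow> real" where
  "laplacian F x = (\<Sum>i\<in>UNIV. partial_deriv i (partial_deriv i F) x)"

definition C2_on :: "(real^'n::finite) set \<Rightarrow> (real^'n \<Rightarrow> real) \<Rightarrow> bool" where
  "C2_on U F \<longleftrightarrow>
     open U \<and>
     (\<forall>x\<in>U. F differentiable (at x)) \<and>
     (\<forall>i. \<forall>x\<in>U. partial_deriv i F differentiable (at x)) \<and>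
     (\<forall>i j. continuous_on U (partial_deriv j (partial_deriv i F)))"

definition regular_defining_function ::
  "(real^'n::finite) set \<Rightarrow> real^'n \<Rightarrow> (real^'n) set \<Rightarrow> (real^'n \<Rightarrow> real) \<Rightarrow> bool" where
  "regular_defining_function S p U F \<longleftrightarrow>
     p \<in> S \<and> open U \<and> p \<in> U \<and> C2_on U F \<and>
     S \<inter> U = {x \<in> U. F x = 0} \<and>
     (\<forall>x \<in> S \<inter> U. gradient F x \<noteq> 0)"

definition embedded_C2_hypersurface :: "(real^'n::finite) set \<Rightarrow> bool" where
  "embedded_C2_hypersurface S \<longleftrightarrow> (\<forall>p\<in>S. \<exists>U F. regular_defining_function S p U F)"

definition M_op :: "(real^'n::finite \<Rightarrow> real) \<Rightarrow> real^'n \<Rightarrow> real" where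
  "M_op G x = (norm (gradient G x))\<^sup>2 * laplacian G x
                - hess G x (gradient G x) (gradient G x)"

definition C_coef :: "'n::finite \<Rightarrow> 'n \<Rightarrow> (real^'n \<Rightarrow> real) \<Rightarrow> real^'n \<Rightarrow> real" where
  "C_coef i j F x =
     (partial_deriv j F x)\<^sup>2 * partial_deriv i (partial_deriv i F) x
     + (partial_deriv i F x)\<^sup>2 * partial_deriv j (partial_deriv j F) x
     - 2 * partial_deriv i F x * partial_deriv j F x * partial_deriv j (partial_deriv i F) x"

definition dilation :: "real^'n::finite \<Rightarrow> real \<Rightarrow> real^'n^'n" where
  "dilation g t = (\<chi> i j. if i = j then t powr (g $ i) else 0)"

definition dilated :: "real^'n::finite \<Rightarrow> real \<Rightarrow> (real^'n \<Rightarrow> real) \<Rightarrow> real^'n \<Rightarrow> real" where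
  "dilated g t F y = F (matrix_inv (dilation g t) *v y)"

end

theory Submission
  imports Defs
begin

text \<open>
  Since \<open>F\<^sub>t = F \<circ> D\<^sub>t\<inverse>\<close>, each \<open>i\<close>-th partial derivative of \<open>F\<^sub>t\<close> picks up a
  factor \<open>t powr (- g $ i)\<close>. In \<open>\<M>[G] = \<Sum>\<^sub>i\<^sub>,\<^sub>j (G\<^sub>i\<^sup>2 G\<^sub>j\<^sub>j - G\<^sub>i G\<^sub>j G\<^sub>i\<^sub>j)\<close> the
  diagonal terms cancel, and by the symmetry of second derivatives the terms \<open>(i, j)\<close>
  and \<open>(j, i)\<close> add up to \<open>C\<^sub>i\<^sub>j[G]\<close>, which is homogeneous of degree two in each of
  the indices \<open>i\<close> and \<open>j\<close>.
\<close>

section \<open>Computation and locality of partial derivatives\<close>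

lemma partial_deriv_eqI:
  assumes "(F has_derivative F') (at x)"
  shows "partial_deriv i F x = F' (axis i 1)"
  using frechet_derivative_at[OF assms] by (simp add: partial_deriv_def)

text \<open>Both functions admit the same derivatives at \<open>x\<close>, and
  \<open>frechet_derivative\<close> chooses from these, so the values agree even at points of
  non-differentiability. This lets a formula valid only on an open set be differentiated
  again.\<close>

lemma partial_deriv_cong_open:
  assumes "open V" "x \<in> V" "\<And>y. y \<in> V \<Longrightarrow> F y = G y"
  shows "partial_deriv i F x = partial_deriv i G x"
proof -
  have "(F has_derivative F') (at x) \<longleftrightarrow> (G has_derivative F') (at x)" for F'
    using assms by (auto intro: has_derivative_transform_within_open)
  then show ?thesis
    by (simp add: partial_deriv_def frechet_derivative_def)
qed

section \<open>Symmetry of the mixed second derivatives\<close>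

lemma has_real_derivative_along_axis:
  fixes F :: "real^'n::finite \<Rightarrow> real"
  assumes "F differentiable (at (x + s *\<^sub>R axis i 1))"
  shows "((\<lambda>s. F (x + s *\<^sub>R axis i 1)) has_real_derivative
    partial_deriv i F (x + s *\<^sub>R axis i 1)) (at s)"
proof -
  let ?y = "x + s *\<^sub>R axis i 1"
  have D: "(F has_derivative frechet_derivative F (at ?y)) (at ?y)"
    using assms frechet_derivative_works by blast
  have "((\<lambda>s. x + s *\<^sub>R axis i 1) has_derivative (\<lambda>h. h *\<^sub>R axis i 1)) (at s)"
    by (auto intro!: derivative_eq_intros)
  from has_derivative_compose[OF this D] show ?thesis
    by (simp add: has_field_derivative_def partial_deriv_def mult_commute_abs
        linear_scale[OF has_derivative_linear[OF D]] mult.commute)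
qed

text \<open>The mean value theorem is applied first along axis \<open>i\<close> and then along axis
  \<open>j\<close>. The second difference on the left is symmetric in \<open>i\<close> and
  \<open>j\<close>, which is what the proof of \<open>partial_deriv_commute\<close>
  exploits.\<close>

lemma second_difference_mean_value:
  fixes F :: "real^'n::finite \<Rightarrow> real"
  assumes "0 < h"
    and U: "\<And>s r. 0 \<le> s \<Longrightarrow> s \<le> h \<Longrightarrow> 0 \<le> r \<Longrightarrow> r \<le> h \<Longrightarrow>
        x + s *\<^sub>R axis i 1 + r *\<^sub>R axis j 1 \<in> U"
    and F: "\<And>y. y \<in> U \<Longrightarrow> F differentiable (at y)"
    and Fi: "\<And>y. y \<in> U \<Longrightarrow> partial_deriv i F differentiable (at y)"
  obtains s r where "0 < s" "s < h" "0 < r" "r < h"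
    "F (x + h *\<^sub>R axis i 1 + h *\<^sub>R axis j 1) - F (x + h *\<^sub>R axis i 1)
       - F (x + h *\<^sub>R axis j 1) + F x
     = h\<^sup>2 * partial_deriv j (partial_deriv i F) (x + s *\<^sub>R axis i 1 + r *\<^sub>R axis j 1)"
proof -
  let ?u = "axis i 1 :: real^'n" and ?v = "axis j 1 :: real^'n"
  \<comment> \<open>The increment of \<open>F\<close> over a step \<open>h\<close> along axis
    \<open>j\<close>, as a function of the position along axis \<open>i\<close>;
    \<open>\<phi> h - \<phi> 0\<close> is the second difference.\<close>
  define \<phi> where "\<phi> s = F ((x + h *\<^sub>R ?v) + s *\<^sub>R ?u) - F (x + s *\<^sub>R ?u)" for s
  have "(\<phi> has_real_derivative
      partial_deriv i F ((x + h *\<^sub>R ?v) + s *\<^sub>R ?u) - partial_deriv i F (x + s *\<^sub>R ?u)) (at s)"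
    if "0 \<le> s" "s \<le> h" for s
    unfolding \<phi>_def
    using U[OF that, of h] U[OF that, of 0] \<open>0 < h\<close>
    by (intro DERIV_diff has_real_derivative_along_axis F) (simp_all add: algebra_simps)
  from MVT2[OF \<open>0 < h\<close>, of \<phi>, OF this]
  obtain s where s: "0 < s" "s < h" and 1: "\<phi> h - \<phi> 0 = h *
      (partial_deriv i F ((x + h *\<^sub>R ?v) + s *\<^sub>R ?u) - partial_deriv i F (x + s *\<^sub>R ?u))"
    by auto
  \<comment> \<open>With \<open>s\<close> fixed, the derivative of \<open>\<phi>\<close> at
    \<open>s\<close> is itself an increment, \<open>\<psi> h - \<psi> 0\<close>.\<close>
  define \<psi> where "\<psi> r = partial_deriv i F ((x + s *\<^sub>R ?u) + r *\<^sub>R ?v)" for r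
  have "(\<psi> has_real_derivative
      partial_deriv j (partial_deriv i F) ((x + s *\<^sub>R ?u) + r *\<^sub>R ?v)) (at r)"
    if "0 \<le> r" "r \<le> h" for r
    unfolding \<psi>_def using U[of s r] s that
    by (intro has_real_derivative_along_axis Fi) simp
  from MVT2[OF \<open>0 < h\<close>, of \<psi>, OF this]
  obtain r where r: "0 < r" "r < h" and 2: "\<psi> h - \<psi> 0 = h *
      partial_deriv j (partial_deriv i F) ((x + s *\<^sub>R ?u) + r *\<^sub>R ?v)"
    by auto
  have "\<phi> h - \<phi> 0 = h * (\<psi> h - \<psi> 0)"
    using 1 by (simp add: \<psi>_def add.commute add.left_commute)
  then have "\<phi> h - \<phi> 0 = h\<^sup>2 * partial_deriv j (partial_deriv i F) (x + s *\<^sub>R ?u + r *\<^sub>R ?v)"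
    using 2 by (simp add: power2_eq_square)
  then show thesis
    using s r by (intro that[of s r]) (simp_all add: \<phi>_def algebra_simps)
qed

text \<open>Schwarz's theorem. Arbitrarily near \<open>x\<close> the two mixed derivatives share a
  value, both being the same second difference divided by \<open>h\<^sup>2\<close>; continuity
  excludes a gap between them at \<open>x\<close>.\<close>

lemma partial_deriv_commute:
  fixes F :: "real^'n::finite \<Rightarrow> real"
  assumes C2: "C2_on U F" and "x \<in> U"
  shows "partial_deriv j (partial_deriv i F) x = partial_deriv i (partial_deriv j F) x"
proof (rule ccontr)
  let ?A = "partial_deriv j (partial_deriv i F)" and ?B = "partial_deriv i (partial_deriv j F)"
  assume "?A x \<noteq> ?B x"
  then have "0 < dist (?A x) (?B x) / 2" (is "0 < ?e") by simp
  have "open U" using C2 by (simp add: C2_on_def)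
  have "isCont ?A x" "isCont ?B x"
    using C2 \<open>x \<in> U\<close> by (auto simp: C2_on_def continuous_on_eq_continuous_at)
  obtain d1 where d1: "d1 > 0" "\<And>y. dist y x < d1 \<Longrightarrow> dist (?A y) (?A x) < ?e"
    using \<open>isCont ?A x\<close> \<open>0 < ?e\<close> unfolding continuous_at_eps_delta by blast
  obtain d2 where d2: "d2 > 0" "\<And>y. dist y x < d2 \<Longrightarrow> dist (?B y) (?B x) < ?e"
    using \<open>isCont ?B x\<close> \<open>0 < ?e\<close> unfolding continuous_at_eps_delta by blast
  obtain d3 where d3: "d3 > 0" "\<And>y. dist y x < d3 \<Longrightarrow> y \<in> U"
    using \<open>open U\<close> \<open>x \<in> U\<close> open_dist by blast
  define \<delta> where "\<delta> = min d1 (min d2 d3)"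
  \<comment> \<open>Two steps of length at most \<open>h\<close> move a point by at most two thirds
    of \<open>\<delta>\<close>, hence strictly less than \<open>\<delta>\<close>.\<close>
  define h where "h = \<delta> / 3"
  have "\<delta> > 0" using d1 d2 d3 by (simp add: \<delta>_def)
  then have "h > 0" by (simp add: h_def)
  have near: "dist (x + s *\<^sub>R axis k 1 + r *\<^sub>R axis l 1) x < \<delta>"
    if "0 \<le> s" "s \<le> h" "0 \<le> r" "r \<le> h" for s r and k l :: 'n
  proof -
    have "norm (s *\<^sub>R axis k 1 + r *\<^sub>R axis l 1 :: real^'n) \<le> s + r"
      using that by (intro norm_triangle_le) (simp add: norm_axis_1)
    also have "s + r < \<delta>" using that \<open>\<delta> > 0\<close> by (simp add: h_def)
    finally show ?thesis by (simp add: dist_norm add.assoc)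
  qed
  then have inU: "x + s *\<^sub>R axis k 1 + r *\<^sub>R axis l 1 \<in> U"
    if "0 \<le> s" "s \<le> h" "0 \<le> r" "r \<le> h" for s r and k l :: 'n
    using d3 that by (simp add: \<delta>_def)
  have F: "\<And>y. y \<in> U \<Longrightarrow> F differentiable (at y)"
    "\<And>y k. y \<in> U \<Longrightarrow> partial_deriv k F differentiable (at y)"
    using C2 by (auto simp: C2_on_def)
  obtain s r where sr: "0 < s" "s < h" "0 < r" "r < h"
    "F (x + h *\<^sub>R axis i 1 + h *\<^sub>R axis j 1) - F (x + h *\<^sub>R axis i 1)
       - F (x + h *\<^sub>R axis j 1) + F x = h\<^sup>2 * ?A (x + s *\<^sub>R axis i 1 + r *\<^sub>R axis j 1)"
    using second_difference_mean_value[OF \<open>h > 0\<close> inU F] by blast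
  obtain s' r' where sr': "0 < s'" "s' < h" "0 < r'" "r' < h"
    "F (x + h *\<^sub>R axis j 1 + h *\<^sub>R axis i 1) - F (x + h *\<^sub>R axis j 1)
       - F (x + h *\<^sub>R axis i 1) + F x = h\<^sup>2 * ?B (x + s' *\<^sub>R axis j 1 + r' *\<^sub>R axis i 1)"
    using second_difference_mean_value[OF \<open>h > 0\<close> inU F] by blast
  let ?y = "x + s *\<^sub>R axis i 1 + r *\<^sub>R axis j 1" and ?z = "x + s' *\<^sub>R axis j 1 + r' *\<^sub>R axis i 1"
  \<comment> \<open>Exchanging the two axes permutes the corners, so both second differences are the
    same number.\<close>
  have "x + h *\<^sub>R axis j 1 + h *\<^sub>R axis i 1 = x + h *\<^sub>R axis i 1 + h *\<^sub>R axis j 1"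
    by (simp add: algebra_simps)
  then have "h\<^sup>2 * ?A ?y = h\<^sup>2 * ?B ?z"
    using sr(5) sr'(5) by (simp only:)
  then have "?A ?y = ?B ?z" using \<open>h > 0\<close> by simp
  moreover have "dist (?A ?y) (?A x) < ?e"
    by (rule d1(2)) (use near[of s r i j] sr in \<open>simp add: \<delta>_def\<close>)
  moreover have "dist (?B ?z) (?B x) < ?e"
    by (rule d2(2)) (use near[of s' r' j i] sr' in \<open>simp add: \<delta>_def\<close>)
  \<comment> \<open>The common value would lie within half the gap of both \<open>?A x\<close> and
    \<open>?B x\<close>.\<close>
  ultimately show False
    using dist_triangle_half_r by fastforce
qed

section \<open>Decomposition of \<open>M_op\<close> into the coefficients
  \<open>C_coef\<close>\<close>

lemma M_op_eq_sum_C_coef: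
  fixes G :: "real^'n::{finite,linorder} \<Rightarrow> real"
  assumes sym: "\<And>i j. partial_deriv j (partial_deriv i G) x = partial_deriv i (partial_deriv j G) x"
  shows "M_op G x = (\<Sum>(i, j) \<in> {(i, j). i < j}. C_coef i j G x)"
proof -
  let ?D = "\<lambda>i. partial_deriv i G x" and ?H = "\<lambda>i j. partial_deriv j (partial_deriv i G) x"
  let ?f = "\<lambda>(i, j). (?D i)\<^sup>2 * ?H j j - ?H i j * ?D i * ?D j"
  let ?L = "{(i, j). i < j} :: ('n \<times> 'n) set" and ?R = "{(i, j). j < i} :: ('n \<times> 'n) set"
  have "(norm (gradient G x))\<^sup>2 = (\<Sum>i\<in>UNIV. (?D i)\<^sup>2)"
    unfolding power2_norm_eq_inner by (simp add: inner_vec_def gradient_def power2_eq_square)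
  then have "M_op G x = (\<Sum>i\<in>UNIV. \<Sum>j\<in>UNIV. ?f (i, j))"
    by (simp add: M_op_def laplacian_def hess_def gradient_def sum_product sum_subtractf)
  also have "\<dots> = sum ?f UNIV"
    by (simp only: sum.cartesian_product UNIV_Times_UNIV) (simp add: case_prod_unfold)
  \<comment> \<open>Only the diagonal is dropped, where the two products in \<open>?f\<close>
    coincide.\<close>
  also have "\<dots> = sum ?f (?L \<union> ?R)"
    by (intro sum.mono_neutral_right) (auto simp: power2_eq_square not_less_iff_gr_or_eq)
  also have "\<dots> = sum ?f ?L + sum ?f ?R"
    by (intro sum.union_disjoint) auto
  also have "sum ?f ?R = (\<Sum>(i, j)\<in>?L. ?f (j, i))"
    by (intro sum.reindex_bij_witness[of _ prod.swap prod.swap]) auto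
  \<comment> \<open>Symmetry at \<open>x\<close> merges \<open>?H i j\<close> and
    \<open>?H j i\<close> into the doubled mixed term of \<open>C_coef\<close>.\<close>
  also have "sum ?f ?L + \<dots> = (\<Sum>(i, j)\<in>?L. C_coef i j G x)"
    unfolding sum.distrib[symmetric]
    by (intro sum.cong refl) (auto simp: C_coef_def sym algebra_simps)
  finally show ?thesis .
qed

section \<open>Chain rule for diagonal linear maps\<close>

lemma partial_deriv_compose_diagonal:
  fixes F :: "real^'n::finite \<Rightarrow> real"
  assumes "F differentiable (at (\<chi> k. a $ k * y $ k))"
  shows "partial_deriv i (\<lambda>y. F (\<chi> k. a $ k * y $ k)) y
    = a $ i * partial_deriv i F (\<chi> k. a $ k * y $ k)"
proof -
  let ?A = "\<lambda>y :: real^'n. \<chi> k. a $ k * y $ k"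
  have "linear ?A"
    by (rule linearI) (auto simp: vec_eq_iff algebra_simps)
  then have A: "(?A has_derivative ?A) (at y)"
    by (simp add: bounded_linear_imp_has_derivative linear_conv_bounded_linear)
  have F: "(F has_derivative frechet_derivative F (at (?A y))) (at (?A y))"
    using assms frechet_derivative_works by blast
  \<comment> \<open>The axes are eigenvectors of \<open>?A\<close>, so no other partial derivatives
    of \<open>F\<close> enter.\<close>
  have "?A (axis i 1) = a $ i *\<^sub>R axis i 1"
    by (auto simp: vec_eq_iff axis_def)
  then show ?thesis
    using partial_deriv_eqI[OF has_derivative_compose[OF A F], of i]
    by (simp add: partial_deriv_def linear_scale[OF has_derivative_linear[OF F]])
qed

text \<open>The first-order formula is available on the preimage of \<open>U\<close>, which is open;
  there it is differentiated once more, with \<open>a $ i * partial_deriv i F\<close> in the role of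
  \<open>F\<close>.\<close>

lemma partial_deriv2_compose_diagonal:
  fixes F :: "real^'n::finite \<Rightarrow> real"
  assumes C2: "C2_on U F" and y: "(\<chi> k. a $ k * y $ k) \<in> U"
  shows "partial_deriv j (partial_deriv i (\<lambda>y. F (\<chi> k. a $ k * y $ k))) y
    = a $ i * a $ j * partial_deriv j (partial_deriv i F) (\<chi> k. a $ k * y $ k)"
proof -
  let ?A = "\<lambda>y :: real^'n. \<chi> k. a $ k * y $ k"
  have "continuous_on UNIV ?A"
    by (intro continuous_intros)
  then have "open (?A -` U)"
    using C2 by (auto simp: C2_on_def open_vimage)
  then have "partial_deriv j (partial_deriv i (\<lambda>y. F (?A y))) y
    = partial_deriv j (\<lambda>y. a $ i * partial_deriv i F (?A y)) y"
    using C2 y by (intro partial_deriv_cong_open[of "?A -` U"])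
      (auto simp: C2_on_def intro!: partial_deriv_compose_diagonal)
  also have "\<dots> = a $ j * partial_deriv j (\<lambda>y. a $ i * partial_deriv i F y) (?A y)"
    using C2 y by (intro partial_deriv_compose_diagonal)
      (auto simp: C2_on_def intro!: differentiable_mult)
  also have "partial_deriv j (\<lambda>y. a $ i * partial_deriv i F y) (?A y)
    = a $ i * partial_deriv j (partial_deriv i F) (?A y)"
    unfolding partial_deriv_def[of j]
    using C2 y
    by (subst frechet_derivative_at[symmetric, OF has_derivative_mult_right])
      (auto simp: C2_on_def frechet_derivative_works[symmetric])
  finally show ?thesis by simp
qed

section \<open>Dilation matrices and their inverses\<close>

lemma dilation_mult_vec: "dilation g t *v x = (\<chi> i. t powr (g $ i) * x $ i)"
  by (simp add: dilation_def matrix_vector_mult_def vec_eq_iff if_distrib[of "\<lambda>c. c * _"] cong: if_cong)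

lemma dilation_uminus_mult:
  assumes "0 < t"
  shows "dilation (- g) t ** dilation g t = mat 1" "dilation g t ** dilation (- g) t = mat 1"
  using assms
  by (auto simp: dilation_def matrix_matrix_mult_def mat_def vec_eq_iff if_distrib[of "\<lambda>c. c * _"]
      powr_minus cong: if_cong)

text \<open>\<open>matrix_inv\<close> is a choice of a two-sided inverse;
  \<open>dilation (- g) t\<close> shows that one exists, and associativity makes it unique.\<close>

lemma matrix_inv_dilation:
  assumes "0 < t"
  shows "matrix_inv (dilation g t) = dilation (- g) t"
proof -
  have "matrix_inv (dilation g t) ** dilation g t = mat 1"
    unfolding matrix_inv_def
    by (rule someI2[of _ "dilation (- g) t"]) (use dilation_uminus_mult[OF assms] in auto)
  then show ?thesis
    by (metis dilation_uminus_mult(2)[OF assms] matrix_mul_assoc matrix_mul_lid matrix_mul_rid)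
qed

text \<open>The weights are packed into a vector so that the right-hand side matches the pattern of
  the chain rule lemmas.\<close>

lemma dilated_eq:
  assumes "0 < t"
  shows "dilated g t F = (\<lambda>y. F (\<chi> k. (\<chi> i. t powr (- g $ i)) $ k * y $ k))"
  by (simp add: fun_eq_iff dilated_def matrix_inv_dilation[OF assms] dilation_mult_vec)

theorem proposition2p5:
  fixes S U :: "(real^'n::{finite,linorder}) set"
    and F :: "real^'n::{finite,linorder} \<Rightarrow> real"
    and g p :: "real^'n::{finite,linorder}"
  assumes "CARD('n) \<ge> 2"
    and "embedded_C2_hypersurface S"
    and "regular_defining_function S p U F"
    and "\<And>i. g $ i > 0"
  shows "\<forall>t>0. \<forall>x \<in> S \<inter> U.
    M_op (dilated g t F) (dilation g t *v x)
      = (\<Sum>(i, j) \<in> {(i, j). i < j}. t powr (-2 * (g $ i + g $ j)) * C_coef i j F x)"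
proof (intro allI impI ballI)
  fix t :: real and x
  assume "0 < t" and x: "x \<in> S \<inter> U"
  have C2: "C2_on U F"
    using assms(3) by (simp add: regular_defining_function_def)
  define a where "a = (\<chi> i. t powr (- g $ i))"
  let ?G = "dilated g t F" and ?y = "dilation g t *v x"
  have G: "?G = (\<lambda>y. F (\<chi> k. a $ k * y $ k))"
    unfolding a_def by (rule dilated_eq[OF \<open>0 < t\<close>])
  \<comment> \<open>The inverse dilation returns \<open>?y\<close> to \<open>x\<close>, so all
    derivatives of \<open>F\<close> are evaluated at \<open>x\<close>.\<close>
  have y: "(\<chi> k. a $ k * ?y $ k) = x"
    using \<open>0 < t\<close> by (simp add: dilation_mult_vec a_def vec_eq_iff powr_minus)
  have D1: "partial_deriv i ?G ?y = a $ i * partial_deriv i F x" for i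
    using partial_deriv_compose_diagonal[of F a ?y i] C2 x unfolding G y
    by (auto simp: C2_on_def)
  have D2: "partial_deriv j (partial_deriv i ?G) ?y
      = a $ i * a $ j * partial_deriv j (partial_deriv i F) x" for i j
    using partial_deriv2_compose_diagonal[OF C2, of a ?y j i] x unfolding G y by auto
  \<comment> \<open>Symmetry for \<open>?G\<close> at \<open>?y\<close> is inherited from
    \<open>F\<close> at \<open>x\<close>, as the factor \<open>a $ i * a $ j\<close> in
    \<open>D2\<close> is itself symmetric.\<close>
  have "M_op ?G ?y = (\<Sum>(i, j) \<in> {(i, j). i < j}. C_coef i j ?G ?y)"
    using partial_deriv_commute[OF C2] x by (intro M_op_eq_sum_C_coef) (auto simp: D2)
  also have "\<dots> = (\<Sum>(i, j) \<in> {(i, j). i < j}. t powr (-2 * (g $ i + g $ j)) * C_coef i j F x)"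
  proof (intro sum.cong refl, clarify)
    fix i j
    \<comment> \<open>Each term of \<open>C_coef i j\<close> carries two derivatives in
      \<open>i\<close> and two in \<open>j\<close>, hence this common factor.\<close>
    have "t powr (-2 * (g $ i + g $ j)) = (a $ i)\<^sup>2 * (a $ j)\<^sup>2"
      by (simp add: a_def power2_eq_square flip: powr_add)
    then show "C_coef i j ?G ?y = t powr (-2 * (g $ i + g $ j)) * C_coef i j F x"
      by (simp add: C_coef_def D1 D2 power2_eq_square algebra_simps)
  qed
  finally show "M_op ?G ?y
    = (\<Sum>(i, j) \<in> {(i, j). i < j}. t powr (-2 * (g $ i + g $ j)) * C_coef i j F x)" .
qed

end
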